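(* Let $\gamma>0$, let $\mathcal{A}$ be any subset of the set of elements $\mathcal{T}^h$ (identified with the union of its elements), and let $(\boldsymbol{u}^h,p^h)\in \vec{V}^h_{\boldsymbol g}\times Q^h$ be any solution of the frozen system $$a_h(\boldsymbol{u}^h,\boldsymbol{v})+\gamma^{-1}(\nabla\cdot\boldsymbol{u}^h,\nabla\cdot\boldsymbol{v})_{\mathcal{A}}-(p^h,\nabla\cdot\boldsymbol{v})_{\mathcal{A}}=L(\boldsymbol{v}),\qquad -(\nabla\cdot\boldsymbol{u}^h,q)_{\mathcal{A}}-\gamma(p^h,q)_{\Omega\setminus\mathcal{A}}=0$$ for all $(\boldsymbol{v},q)\in\vec{V}^h\times Q^h$. Then: (i) $(\nabla\cdot\boldsymbol{u}^h)_T=0$ for $T\in\mathcal{A}$ and $p^h_T=0$ for $T\notin\mathcal{A}$, so that the product $p^h\,\nabla\cdot\boldsymbol{u}^h$ vanishes identically, on every element and for every $\mathcal{A}$. (ii) The test argument $\gamma p^h_T-(\nabla\cdot\boldsymbol{u}^h)_T$ equals $\gamma p^h_T$ for $T\in\mathcal{A}$ and $-(\nabla\cdot\boldsymbol{u}^h)_T$ for $T\notin\mathcal{A}$. (iii) At a fixed point, that is, if $\mathcal{A}=\{T\in\mathcal{T}^h:\gamma p^h_T-(\nabla\cdot\boldsymbol{u}^h)_T\ge 0\}$, one has $p^h_T\ge 0$ for $T\in\mathcal{A}$ and $(\nabla\cdot\boldsymbol{u}^h)_T>0$ for $T\notin\mathcal{A}$. (iv) Neither the frozen solutions (for given $\mathcal{A}$)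 nor the fixed point depend on $\gamma$. (v) A fixed point satisfies the discrete Kuhn--Tucker conditions $p^h\ge 0$, $\nabla\cdot\boldsymbol{u}^h\ge 0$, $p^h\,\nabla\cdot\boldsymbol{u}^h=0$ exactly on every element; in particular $p^h\in Q_+:=\{q\in L_2(\Omega): q\ge 0\}$.
   Context: Let $n\in\{2,3\}$, let $\Omega\subset\mathbb{R}^n$ be a bounded connected polygonal/polyhedral Lipschitz domain with outward unit normal $\boldsymbol n$, and let $\partial\Omega$ be split into disjoint relatively open parts $\Gamma^{\mathrm D},\Gamma^{\mathrm N},\Gamma^{\mathrm S},\Gamma^{\mathrm E}$ (whose closures cover $\partial\Omega$; $|\Gamma^{\mathrm D}|>0$). $\mathcal{T}^h$ is a conforming simplicial mesh of $\Omega$ that resolves the boundary partition, and $\Gamma^{\mathrm N}\cup\Gamma^{\mathrm E}$ contains at least one complete boundary face. $(\cdot,\cdot)_\omega$ is the $L_2(\omega)$ inner product, $\nabla\cdot$ acts elementwise on discrete fields, $[\![\cdot]\!]$ is the jump across an interior face and the trace on a boundary face, and $q_T$ denotes the value on $T$ of an elementwise constant $q$. $\boldsymbol I$ is the identity. Crouzeix--Raviart space: $\vec{V}^h_{\boldsymbol w}$ is the set of $\boldsymbol v\in[L_2(\Omega)]^n$ with $\boldsymbol v|_T\in[\mathbb{P}_1(T)]^n$ for all $T$; $\int_F[\![\boldsymbol v]\!]=\boldsymbol 0$ for interior faces $F$; $\int_F(\boldsymbol v-\boldsymbol w)=\boldsymbol 0$ for $F\subset\Gamma^{\mathrm D}$;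 $\int_F\boldsymbol v\cdot\boldsymbol n=0$ for $F\subset\Gamma^{\mathrm S}$; $\int_F(\boldsymbol I-\boldsymbol n\otimes\boldsymbol n)\boldsymbol v=\boldsymbol 0$ for $F\subset\Gamma^{\mathrm E}$. $\vec V^h:=\vec V^h_{\boldsymbol 0}$. $Q^h$ is the space of elementwise constant functions. $\boldsymbol g$ is given Dirichlet data on $\Gamma^{\mathrm D}$. Viscous form: with constant viscosity $\mu>0$, $\boldsymbol\varepsilon(\boldsymbol u)=\frac12(\nabla\boldsymbol u+(\nabla\boldsymbol u)^{\mathrm T})$ and $\boldsymbol\sigma(\boldsymbol u,0)=2\mu(\boldsymbol\varepsilon(\boldsymbol u)-\frac13(\nabla\cdot\boldsymbol u)\boldsymbol I)$, $$a_h(\boldsymbol u,\boldsymbol v)=\sum_{T}(\boldsymbol\sigma(\boldsymbol u,0),\boldsymbol\varepsilon(\boldsymbol v))_T+2\mu\gamma_1\sum_F(h_F^{-1}[\![\boldsymbol u]\!],[\![\boldsymbol v]\!])_F,\qquad \gamma_1>0,$$ the face sum running over interior faces and faces on $\Gamma^{\mathrm D}$ and $\Gamma^{\mathrm E}$, the jump on $\Gamma^{\mathrm E}$ being replaced by the tangential trace $(\boldsymbol I-\boldsymbol n\otimes\boldsymbol n)\boldsymbol v$; $h_F=(|T^+|+|T^-|)/(2|F|)$ for the elements $T^\pm$ sharing $F$ ($h_F=|T|/|F|$ on a boundary face). Load: $L(\boldsymbol v)=\int_\Omega\boldsymbol f\cdot\boldsymbol v+\int_{\Gamma^{\mathrm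 N}}\boldsymbol t\cdot\boldsymbol v\,\mathrm ds-\int_{\Gamma^{\mathrm E}}p_{\mathrm b}\,\boldsymbol v\cdot\boldsymbol n\,\mathrm ds$ with given data $\boldsymbol f,\boldsymbol t$ and $p_{\mathrm b}\ge0$. The frozen system arises in an active-set iteration: given $\mathcal A$, solve the system, then replace $\mathcal A$ by the set of elements passing the test $\gamma p^h_T-(\nabla\cdot\boldsymbol u^h)_T\ge0$ (ties are assigned to $\mathcal A$). A fixed point is a set $\mathcal A$ and frozen solution for which this update leaves $\mathcal A$ unchanged. *)

theory Defs
  imports "HOL-Analysis.Analysis"
begin

section \<open>Lebesgue and surface integrals\<close>

text \<open>
  Elements of \<open>L\<^sub>2\<close> are represented by functions on the whole space; only their values
  almost everywhere on \<open>S\<close> matter.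
\<close>

definition L2_space :: "'a::euclidean_space set \<Rightarrow> ('a \<Rightarrow> 'b::euclidean_space) set" where
  "L2_space S = {f. f \<in> borel_measurable (lebesgue_on S) \<and>
                    integrable (lebesgue_on S) (\<lambda>x. (norm (f x))\<^sup>2)}"

definition L2_inner ::
    "'a::euclidean_space set \<Rightarrow> ('a \<Rightarrow> 'b::euclidean_space) \<Rightarrow> ('a \<Rightarrow> 'b) \<Rightarrow> real" where
  "L2_inner S f g = (\<integral>x. f x \<bullet> g x \<partial>lebesgue_on S)"

definition hausdorff_content :: "nat \<Rightarrow> real \<Rightarrow> 'a::metric_space set \<Rightarrow> ennreal" where
  "hausdorff_content d \<delta> S =
     (INF U \<in> {U :: nat \<Rightarrow> 'a set. S \<subseteq> (\<Union>i. U i) \<and> (\<forall>i. bounded (U i) \<and> diameter (U i) \<le> \<delta>)}.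
        \<Sum>i. if U i = {} then 0
             else ennreal (unit_ball_vol (real d) * (diameter (U i) / 2) ^ d))"

definition hausdorff_measure :: "nat \<Rightarrow> 'a::metric_space measure" where
  "hausdorff_measure d =
     measure_of UNIV (sets borel) (\<lambda>S. SUP \<delta> \<in> {0<..}. hausdorff_content d \<delta> S)"

text \<open>
  The surface measure \<open>ds\<close> is the \<open>(n - 1)\<close>-dimensional Hausdorff measure, normalised so that
  it is \<open>(n - 1)\<close>-dimensional Lebesgue measure on hyperplanes.
\<close>

definition surface_measure :: "(real^'n) measure" where
  "surface_measure = hausdorff_measure (CARD('n) - 1)"

text \<open>
  Faces of simplices are closed sets, while the boundary parts are relatively open. Integrating
  over the relative interior, which differs from the face by a surface null set, keeps boundary
  data from being evaluated outside the part on which they are given.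
\<close>

definition face_integral ::
    "(real^'n) set \<Rightarrow> (real^'n \<Rightarrow> 'b::euclidean_space) \<Rightarrow> 'b" where
  "face_integral F f = set_lebesgue_integral surface_measure (rel_interior F) f"


section \<open>Domains and meshes\<close>

definition lipschitz_domain :: "(real^'n) set \<Rightarrow> bool" where
  "lipschitz_domain \<Omega> \<longleftrightarrow>
     open \<Omega> \<and> bounded \<Omega> \<and> connected \<Omega> \<and> \<Omega> \<noteq> {} \<and>
     (\<forall>x \<in> frontier \<Omega>. \<exists>e r C. \<exists>\<phi> :: real^'n \<Rightarrow> real.
        norm e = 1 \<and> r > 0 \<and> C-lipschitz_on UNIV \<phi> \<and>
        \<Omega> \<inter> ball x r = {y \<in> ball x r. \<phi> (y - (y \<bullet> e) *\<^sub>R e) < y \<bullet> e})"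

text \<open>The domain need not be convex, unlike the polytopes and polyhedra of the library.\<close>

definition polyhedral_domain :: "(real^'n) set \<Rightarrow> bool" where
  "polyhedral_domain \<Omega> \<longleftrightarrow> (\<exists>\<P>. finite \<P> \<and> (\<forall>K \<in> \<P>. polytope K) \<and> closure \<Omega> = \<Union>\<P>)"

text \<open>
  For a polyhedral domain this is the usual normal at all boundary points near which the
  boundary is flat, that is, at almost all boundary points.
\<close>

definition outward_normal :: "(real^'n) set \<Rightarrow> real^'n \<Rightarrow> real^'n" where
  "outward_normal \<Omega> x =
     (THE \<nu>. norm \<nu> = 1 \<and> (\<exists>r>0. \<Omega> \<inter> ball x r = {y \<in> ball x r. \<nu> \<bullet> (y - x) < 0}))"

text \<open>
  Conformity (two elements meet in a common, possibly empty, face) is part of the library's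
  \<^const>\<open>triangulation\<close>.
\<close>

definition conforming_mesh :: "(real^'n) set \<Rightarrow> (real^'n) set set \<Rightarrow> bool" where
  "conforming_mesh \<Omega> \<T> \<longleftrightarrow>
     triangulation \<T> \<and> (\<forall>T \<in> \<T>. int CARD('n) simplex T) \<and> \<Union>\<T> = closure \<Omega>"

definition mesh_faces :: "(real^'n) set set \<Rightarrow> (real^'n) set set" where
  "mesh_faces \<T> = {F. \<exists>T \<in> \<T>. F facet_of T}"

definition boundary_faces :: "(real^'n) set \<Rightarrow> (real^'n) set set \<Rightarrow> (real^'n) set set" where
  "boundary_faces \<Omega> \<T> = {F \<in> mesh_faces \<T>. F \<subseteq> frontier \<Omega>}"

definition interior_faces :: "(real^'n) set \<Rightarrow> (real^'n) set set \<Rightarrow> (real^'n) set set" where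
  "interior_faces \<Omega> \<T> = mesh_faces \<T> - boundary_faces \<Omega> \<T>"

text \<open>The boundary faces \<open>F \<subset> \<Gamma>\<close> of a relatively open boundary part \<open>\<Gamma>\<close>.\<close>

definition faces_on ::
    "(real^'n) set \<Rightarrow> (real^'n) set set \<Rightarrow> (real^'n) set \<Rightarrow> (real^'n) set set" where
  "faces_on \<Omega> \<T> \<Gamma> = {F \<in> boundary_faces \<Omega> \<T>. rel_interior F \<subseteq> \<Gamma>}"

definition elements_at :: "(real^'n) set set \<Rightarrow> (real^'n) set \<Rightarrow> (real^'n) set set" where
  "elements_at \<T> F = {T \<in> \<T>. F facet_of T}"

text \<open>
  \<open>(|T\<^sup>+| + |T\<^sup>-|) / (2 |F|)\<close> on an interior face, \<open>|T| / |F|\<close> on a boundary face.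
\<close>

definition face_size :: "(real^'n) set set \<Rightarrow> (real^'n) set \<Rightarrow> real" where
  "face_size \<T> F =
     (\<Sum>T \<in> elements_at \<T> F. measure lebesgue T) /
     (real (card (elements_at \<T> F)) * measure surface_measure F)"


section \<open>Elementwise polynomial functions\<close>

definition affine_fields :: "(real^'n \<Rightarrow> real^'n) set" where
  "affine_fields = {w. \<exists>A b. w = (\<lambda>x. A *v x + b)}"

text \<open>
  The polynomial \<open>v|\<^sub>T\<close>, as a function on the whole space; its values on a face of \<open>T\<close> are the
  trace of \<open>v|\<^sub>T\<close>.
\<close>

definition elem_poly :: "(real^'n \<Rightarrow> real^'n) \<Rightarrow> (real^'n) set \<Rightarrow> (real^'n \<Rightarrow> real^'n)" where
  "elem_poly v T = (THE w. w \<in> affine_fields \<and> (AE x in lebesgue_on T. v x = w x))"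

text \<open>The value \<open>q\<^sub>T\<close> of an elementwise constant function.\<close>

definition elem_val :: "(real^'n \<Rightarrow> real) \<Rightarrow> (real^'n) set \<Rightarrow> real" where
  "elem_val q T = (THE c. AE x in lebesgue_on T. q x = c)"

definition broken_grad ::
    "(real^'n) set set \<Rightarrow> (real^'n \<Rightarrow> real^'n) \<Rightarrow> real^'n \<Rightarrow> real^'n^'n" where
  "broken_grad \<T> v x =
     (if \<exists>T \<in> \<T>. x \<in> interior T
      then jacobian (elem_poly v (THE T. T \<in> \<T> \<and> x \<in> interior T)) (at x) else 0)"

definition broken_div :: "(real^'n) set set \<Rightarrow> (real^'n \<Rightarrow> real^'n) \<Rightarrow> real^'n \<Rightarrow> real" where
  "broken_div \<T> v x = trace (broken_grad \<T> v x)"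

text \<open>
  \<open>v\<^sup>+ - v\<^sup>-\<close> on an interior face and the trace of \<open>v\<close> on a boundary face. The (fixed) choice of
  \<open>T\<^sup>+\<close> only affects the sign, on which nothing below depends.
\<close>

definition jump :: "(real^'n) set set \<Rightarrow> (real^'n) set \<Rightarrow> (real^'n \<Rightarrow> real^'n) \<Rightarrow> real^'n \<Rightarrow> real^'n"
  where
  "jump \<T> F v x =
     (let Tp = (SOME T. T \<in> elements_at \<T> F) in
        elem_poly v Tp x - (\<Sum>T \<in> elements_at \<T> F - {Tp}. elem_poly v T x))"

definition boundary_trace ::
    "(real^'n) set \<Rightarrow> (real^'n) set set \<Rightarrow> (real^'n \<Rightarrow> real^'n) \<Rightarrow> real^'n \<Rightarrow> real^'n" where
  "boundary_trace \<Omega> \<T> v x =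
     (if \<exists>F \<in> boundary_faces \<Omega> \<T>. x \<in> rel_interior F
      then jump \<T> (THE F. F \<in> boundary_faces \<Omega> \<T> \<and> x \<in> rel_interior F) v x else 0)"

text \<open>\<open>(I - n \<otimes> n) w\<close> at the boundary point \<open>x\<close>\<close>

definition tangential :: "(real^'n) set \<Rightarrow> real^'n \<Rightarrow> real^'n \<Rightarrow> real^'n" where
  "tangential \<Omega> x w = w - (outward_normal \<Omega> x \<bullet> w) *\<^sub>R outward_normal \<Omega> x"

definition Q_plus :: "(real^'n) set \<Rightarrow> (real^'n \<Rightarrow> real) set" where
  "Q_plus \<Omega> = {q \<in> L2_space \<Omega>. AE x in lebesgue_on \<Omega>. q x \<ge> 0}"


section \<open>The discrete problem\<close>

record ('n::finite) cr_problem =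
  Dom :: "(real^'n) set"
  GammaD :: "(real^'n) set"
  GammaN :: "(real^'n) set"
  GammaS :: "(real^'n) set"
  GammaE :: "(real^'n) set"
  Mesh :: "(real^'n) set set"
  visc :: real                              \<comment> \<open>\<open>\<mu>\<close>\<close>
  penal :: real                             \<comment> \<open>\<open>\<gamma>\<^sub>1\<close>\<close>
  load :: "real^'n \<Rightarrow> real^'n"               \<comment> \<open>\<open>f\<close>\<close>
  traction :: "real^'n \<Rightarrow> real^'n"           \<comment> \<open>\<open>t\<close>, on \<open>\<Gamma>\<^sup>N\<close>\<close>
  pbound :: "real^'n \<Rightarrow> real"                \<comment> \<open>\<open>p\<^sub>b\<close>, on \<open>\<Gamma>\<^sup>E\<close>\<close>
  dirichlet :: "real^'n \<Rightarrow> real^'n"          \<comment> \<open>\<open>g\<close>, on \<open>\<Gamma>\<^sup>D\<close>\<close>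

definition boundary_partition :: "('n::finite) cr_problem \<Rightarrow> bool" where
  "boundary_partition P \<longleftrightarrow>
     (\<forall>\<Gamma> \<in> {GammaD P, GammaN P, GammaS P, GammaE P}.
        openin (top_of_set (frontier (Dom P))) \<Gamma>) \<and>
     disjoint_family_on (\<lambda>i. [GammaD P, GammaN P, GammaS P, GammaE P] ! i) {..<4} \<and>
     closure (GammaD P) \<union> closure (GammaN P) \<union> closure (GammaS P) \<union> closure (GammaE P)
       = frontier (Dom P) \<and>
     emeasure surface_measure (GammaD P) > 0"

definition mesh_resolves_boundary :: "('n::finite) cr_problem \<Rightarrow> bool" where
  "mesh_resolves_boundary P \<longleftrightarrow>
     (\<forall>F \<in> boundary_faces (Dom P) (Mesh P).
        \<exists>\<Gamma> \<in> {GammaD P, GammaN P, GammaS P, GammaE P}. rel_interior F \<subseteq> \<Gamma>)"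

text \<open>Integrability is the least regularity of the data for which all terms below make sense.\<close>

definition admissible_problem :: "('n::finite) cr_problem \<Rightarrow> bool" where
  "admissible_problem P \<longleftrightarrow>
     CARD('n) \<in> {2, 3} \<and>
     lipschitz_domain (Dom P) \<and> polyhedral_domain (Dom P) \<and>
     boundary_partition P \<and>
     conforming_mesh (Dom P) (Mesh P) \<and> mesh_resolves_boundary P \<and>
     (\<exists>F \<in> boundary_faces (Dom P) (Mesh P). rel_interior F \<subseteq> GammaN P \<union> GammaE P) \<and>
     visc P > 0 \<and> penal P > 0 \<and>
     integrable (lebesgue_on (Dom P)) (load P) \<and>
     set_integrable surface_measure (GammaN P) (traction P) \<and>
     set_integrable surface_measure (GammaE P) (pbound P) \<and>
     (AE x in surface_measure. x \<in> GammaE P \<longrightarrow> pbound P x \<ge> 0) \<and>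
     set_integrable surface_measure (GammaD P) (dirichlet P)"

definition CR_space ::
    "('n::finite) cr_problem \<Rightarrow> (real^'n \<Rightarrow> real^'n) \<Rightarrow> (real^'n \<Rightarrow> real^'n) set" where
  "CR_space P w =
     {v \<in> L2_space (Dom P).
        (\<forall>T \<in> Mesh P. \<exists>a \<in> affine_fields. AE x in lebesgue_on T. v x = a x) \<and>
        (\<forall>F \<in> interior_faces (Dom P) (Mesh P). face_integral F (jump (Mesh P) F v) = 0) \<and>
        (\<forall>F \<in> faces_on (Dom P) (Mesh P) (GammaD P).
           face_integral F (\<lambda>x. jump (Mesh P) F v x - w x) = 0) \<and>
        (\<forall>F \<in> faces_on (Dom P) (Mesh P) (GammaS P).
           face_integral F (\<lambda>x. jump (Mesh P) F v x \<bullet> outward_normal (Dom P) x) = 0) \<and>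
        (\<forall>F \<in> faces_on (Dom P) (Mesh P) (GammaE P).
           face_integral F (\<lambda>x. tangential (Dom P) x (jump (Mesh P) F v x)) = 0)}"

definition Q_space :: "('n::finite) cr_problem \<Rightarrow> (real^'n \<Rightarrow> real) set" where
  "Q_space P = {q \<in> L2_space (Dom P). \<forall>T \<in> Mesh P. \<exists>c. AE x in lebesgue_on T. q x = c}"

definition strain :: "real^'n^'n \<Rightarrow> real^'n^'n" where
  "strain G = (1/2) *\<^sub>R (G + transpose G)"

text \<open>\<open>\<sigma>(u, 0)\<close> in terms of \<open>G = \<nabla>u\<close>; the factor is \<open>1/3\<close> also in two dimensions.\<close>

definition viscous_stress :: "real \<Rightarrow> real^'n^'n \<Rightarrow> real^'n^'n" where
  "viscous_stress \<mu> G = (2 * \<mu>) *\<^sub>R (strain G - (1/3 * trace G) *\<^sub>R mat 1)"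

definition viscous_form ::
    "('n::finite) cr_problem \<Rightarrow> (real^'n \<Rightarrow> real^'n) \<Rightarrow> (real^'n \<Rightarrow> real^'n) \<Rightarrow> real" where
  "viscous_form P u v =
     (\<Sum>T \<in> Mesh P. L2_inner T (\<lambda>x. viscous_stress (visc P) (broken_grad (Mesh P) u x))
                               (\<lambda>x. strain (broken_grad (Mesh P) v x)))
     + 2 * visc P * penal P *
       ((\<Sum>F \<in> interior_faces (Dom P) (Mesh P) \<union> faces_on (Dom P) (Mesh P) (GammaD P).
           face_integral F (\<lambda>x.
             (inverse (face_size (Mesh P) F) *\<^sub>R jump (Mesh P) F u x) \<bullet> jump (Mesh P) F v x))
        + (\<Sum>F \<in> faces_on (Dom P) (Mesh P) (GammaE P).
           face_integral F (\<lambda>x.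
             (inverse (face_size (Mesh P) F) *\<^sub>R tangential (Dom P) x (jump (Mesh P) F u x))
             \<bullet> tangential (Dom P) x (jump (Mesh P) F v x))))"

definition load_form :: "('n::finite) cr_problem \<Rightarrow> (real^'n \<Rightarrow> real^'n) \<Rightarrow> real" where
  "load_form P v =
     L2_inner (Dom P) (load P) v
     + set_lebesgue_integral surface_measure (GammaN P)
         (\<lambda>x. traction P x \<bullet> boundary_trace (Dom P) (Mesh P) v x)
     - set_lebesgue_integral surface_measure (GammaE P)
         (\<lambda>x. pbound P x * (boundary_trace (Dom P) (Mesh P) v x \<bullet> outward_normal (Dom P) x))"

definition frozen_solution ::
    "('n::finite) cr_problem \<Rightarrow> real \<Rightarrow> (real^'n) set set \<Rightarrow>
     (real^'n \<Rightarrow> real^'n) \<Rightarrow> (real^'n \<Rightarrow> real) \<Rightarrow> bool" where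
  "frozen_solution P \<gamma> \<A> u p \<longleftrightarrow>
     u \<in> CR_space P (dirichlet P) \<and> p \<in> Q_space P \<and>
     (\<forall>v \<in> CR_space P (\<lambda>x. 0). \<forall>q \<in> Q_space P.
        viscous_form P u v
          + inverse \<gamma> * L2_inner (\<Union>\<A>) (broken_div (Mesh P) u) (broken_div (Mesh P) v)
          - L2_inner (\<Union>\<A>) p (broken_div (Mesh P) v) = load_form P v \<and>
        - L2_inner (\<Union>\<A>) (broken_div (Mesh P) u) q
          - \<gamma> * L2_inner (Dom P - \<Union>\<A>) p q = 0)"

definition active_update ::
    "('n::finite) cr_problem \<Rightarrow> real \<Rightarrow> (real^'n \<Rightarrow> real^'n) \<Rightarrow> (real^'n \<Rightarrow> real) \<Rightarrow> (real^'n) set set"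
  where
  "active_update P \<gamma> u p =
     {T \<in> Mesh P. \<gamma> * elem_val p T - elem_val (broken_div (Mesh P) u) T \<ge> 0}"

definition fixed_point ::
    "('n::finite) cr_problem \<Rightarrow> real \<Rightarrow> (real^'n) set set \<Rightarrow>
     (real^'n \<Rightarrow> real^'n) \<Rightarrow> (real^'n \<Rightarrow> real) \<Rightarrow> bool" where
  "fixed_point P \<gamma> \<A> u p \<longleftrightarrow>
     \<A> \<subseteq> Mesh P \<and> frozen_solution P \<gamma> \<A> u p \<and> active_update P \<gamma> u p = \<A>"

end

theory Submission
  imports Defs
begin

text \<open>
  Testing the second equation with the indicator of the interior of an element \<open>T\<close> isolates
  \<open>(\<nabla> \<cdot> u)\<^sub>T |T| = 0\<close> if \<open>T\<close> is active and \<open>\<gamma> p\<^sub>T |T| = 0\<close> otherwise. Hence both terms that carry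
  \<open>\<gamma>\<close> vanish at every frozen solution, whatever the value of \<open>\<gamma>\<close>, and the sign of the test
  argument is that of \<open>p\<^sub>T\<close> or of \<open>- (\<nabla> \<cdot> u)\<^sub>T\<close>.
\<close>

section \<open>Values determined almost everywhere on an element\<close>

lemma AE_lebesgue_on_iff:
  assumes "S \<in> sets lebesgue"
  shows "(AE x in lebesgue_on S. P x) \<longleftrightarrow> (AE x in lebesgue. x \<in> S \<longrightarrow> P x)"
  using assms by (intro AE_restrict_space_iff) auto

text \<open>A nonempty open set is not negligible, so a property true almost everywhere cannot fail
  on all of it. This is how almost-everywhere equalities become equalities at an actual
  point.\<close>

lemma AE_lebesgue_on_open_witness:
  assumes "S \<in> sets lebesgue" "AE x in lebesgue_on S. P x"
    and "open U" "U \<noteq> {}" "U \<subseteq> S"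
  obtains x where "x \<in> U" "P x"
proof -
  have "\<exists>x\<in>U. P x"
  proof (rule ccontr)
    assume "\<not> (\<exists>x\<in>U. P x)"
    moreover have "AE x in lebesgue. x \<in> S \<longrightarrow> P x"
      using assms by (simp add: AE_lebesgue_on_iff)
    ultimately have "AE x in lebesgue. x \<notin> U"
      using assms(5) by (auto elim!: eventually_mono)
    then have "U \<in> null_sets lebesgue"
      by (simp add: completion.null_sets_iff_AE)
    then show False
      using open_not_negligible assms(3,4) by (auto simp: negligible_iff_null_sets)
  qed
  then show thesis using that by blast
qed

text \<open>Uniqueness for the definite description in \<open>elem_val\<close>: two candidate
  constants are compared at one point of the interior where both equal \<open>q\<close>.\<close>

lemma elem_val_eqI:
  assumes "T \<in> sets lebesgue" "interior T \<noteq> {}" "AE x in lebesgue_on T. q x = c"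
  shows "elem_val q T = c"
  unfolding elem_val_def
proof (rule the_equality)
  fix d assume "AE x in lebesgue_on T. q x = d"
  then have "AE x in lebesgue_on T. q x = c \<and> q x = d"
    using assms(3) by (rule AE_conjI[rotated])
  then obtain x where "q x = c \<and> q x = d"
    by (rule AE_lebesgue_on_open_witness[OF assms(1) _ open_interior assms(2) interior_subset])
  then show "d = c" by simp
qed (rule assms)

text \<open>The points of \<open>interior T\<close> where the fields differ form an open set by
  continuity; it meets the exceptional null set only, so it is empty. The coincidence set is affine,
  and a nonempty open set already has the whole space as its affine hull.\<close>

lemma affine_fields_eq_if_AE_eq:
  assumes "T \<in> sets lebesgue" "interior T \<noteq> {}" "a \<in> affine_fields" "b \<in> affine_fields"
    and "AE x in lebesgue_on T. a x = b x"
  shows "a = b"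
proof -
  obtain A c where a: "a = (\<lambda>x. A *v x + c)" using assms(3) by (auto simp: affine_fields_def)
  obtain B d where b: "b = (\<lambda>x. B *v x + d)" using assms(4) by (auto simp: affine_fields_def)
  define U where "U = interior T \<inter> {x. a x \<noteq> b x}"
  have "continuous_on UNIV a" "continuous_on UNIV b"
    unfolding a b by (intro continuous_intros matrix_vector_mult_linear_continuous_on)+
  then have "open U" unfolding U_def by (intro open_Int open_interior open_Collect_neq)
  have "U = {}"
  proof (rule ccontr)
    assume "U \<noteq> {}"
    then obtain x where "x \<in> U" "a x = b x"
      using AE_lebesgue_on_open_witness[OF assms(1,5) \<open>open U\<close>] interior_subset
      unfolding U_def by blast
    then show False by (simp add: U_def)
  qed
  have "affine {x. a x = b x}"
    unfolding affine_def
  proof clarify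
    fix x y and s t :: real
    assume eq: "a x = b x" "a y = b y" and st: "s + t = 1"
    have comb: "M *v (s *\<^sub>R x + t *\<^sub>R y) + e = s *\<^sub>R (M *v x + e) + t *\<^sub>R (M *v y + e)"
      for M :: "real^'a^'a" and e
    proof -
      have "e = s *\<^sub>R e + t *\<^sub>R e" using st by (metis scaleR_add_left scaleR_one)
      then show ?thesis
        by (simp add: matrix_vector_right_distrib matrix_vector_mult_scaleR scaleR_right_distrib
            algebra_simps)
    qed
    show "a (s *\<^sub>R x + t *\<^sub>R y) = b (s *\<^sub>R x + t *\<^sub>R y)"
      using eq unfolding a b comb by simp
  qed
  then have "affine hull (interior T) \<subseteq> {x. a x = b x}"
    using \<open>U = {}\<close> by (intro hull_minimal) (auto simp: U_def)
  moreover have "affine hull (interior T) = UNIV"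
    using assms(2) by (intro affine_hull_nonempty_interior) simp
  ultimately have "a x = b x" for x by blast
  then show ?thesis by (rule ext)
qed

lemma elem_poly_eqI:
  assumes "T \<in> sets lebesgue" "interior T \<noteq> {}" "a \<in> affine_fields"
    and "AE x in lebesgue_on T. v x = a x"
  shows "elem_poly v T = a"
  unfolding elem_poly_def
proof (rule the_equality)
  fix b assume b: "b \<in> affine_fields \<and> (AE x in lebesgue_on T. v x = b x)"
  then have "AE x in lebesgue_on T. b x = a x"
    using assms(4) by (auto elim: eventually_elim2)
  then show "b = a" using affine_fields_eq_if_AE_eq assms b by blast
qed (use assms in blast)

lemma jacobian_affine:
  fixes A :: "real^'n^'m"
  shows "jacobian (\<lambda>x. A *v x + b) (at x) = A"
proof -
  have "((\<lambda>x. A *v x + b) has_derivative (\<lambda>h. A *v h)) (at x)"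
    by (rule has_derivative_eq_rhs,
        rule has_derivative_add[OF bounded_linear_imp_has_derivative has_derivative_const])
      auto
  then have "frechet_derivative (\<lambda>x. A *v x + b) (at x) = (*v) A"
    by (simp add: frechet_derivative_at[symmetric])
  then show ?thesis by (simp add: jacobian_def matrix_of_matrix_vector_mul)
qed

section \<open>Inner products with indicators and with vanishing factors\<close>

lemma L2_inner_indicator:
  fixes f :: "'a::euclidean_space \<Rightarrow> real"
  assumes S: "S \<in> sets lebesgue" and U: "U \<in> lmeasurable"
    and AE: "AE x in lebesgue. x \<in> S \<inter> U \<longrightarrow> f x = c"
  shows "L2_inner S f (indicator U) = c * measure lebesgue (S \<inter> U)"
proof -
  let ?g = "\<lambda>x. indicator S x *\<^sub>R (f x \<bullet> indicator U x)"
  let ?h = "\<lambda>x. c * indicator (S \<inter> U) x"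
  have SU: "S \<inter> U \<in> lmeasurable" using S U by (metis Int_commute fmeasurable_Int_fmeasurable)
  have eq: "AE x in lebesgue. ?h x = ?g x"
    using AE by eventually_elim (auto simp: indicator_def)
  have h: "?h \<in> borel_measurable lebesgue"
    using SU by (intro borel_measurable_times borel_measurable_indicator) (auto simp: fmeasurableD)
  have "L2_inner S f (indicator U) = integral\<^sup>L lebesgue ?g"
    unfolding L2_inner_def using S by (subst integral_restrict_space) auto
  also have "\<dots> = integral\<^sup>L lebesgue ?h"
    \<comment> \<open>Lebesgue measure is complete, so \<open>?g\<close> inherits measurability from
      the function \<open>?h\<close> that it equals almost everywhere.\<close>
    using borel_measurable_AE[OF h eq] h eq by (intro integral_cong_AE) (auto elim: eventually_mono)
  also have "\<dots> = c * measure lebesgue (S \<inter> U)" by simp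
  finally show ?thesis .
qed

lemma L2_inner_eq_zero_left:
  assumes "S \<in> sets lebesgue" "AE x in lebesgue. x \<in> S \<longrightarrow> f x = 0"
  shows "L2_inner S f g = 0"
proof -
  have "AE x in lebesgue_on S. f x \<bullet> g x = 0"
    using assms by (auto simp: AE_lebesgue_on_iff elim: eventually_mono)
  then show ?thesis unfolding L2_inner_def by (rule integral_eq_zero_AE)
qed

section \<open>Geometry of the mesh\<close>

text \<open>Excludes slits: near a boundary point the domain lies strictly above a Lipschitz graph,
  and the points strictly below it form an open set that the closure cannot reach. It is needed
  because the mesh covers the closure, while element interiors must lie in the domain
  itself.\<close>

lemma lipschitz_domain_interior_closure:
  assumes "lipschitz_domain \<Omega>"
  shows "interior (closure \<Omega>) \<subseteq> \<Omega>"
proof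
  fix x assume x: "x \<in> interior (closure \<Omega>)"
  show "x \<in> \<Omega>"
  proof (rule ccontr)
    assume "x \<notin> \<Omega>"
    have "open \<Omega>" using assms by (simp add: lipschitz_domain_def)
    have "x \<in> frontier \<Omega>"
      using x \<open>x \<notin> \<Omega>\<close> \<open>open \<Omega>\<close> interior_subset by (auto simp: frontier_def interior_open)
    then obtain e r C and \<phi> :: "real^'a \<Rightarrow> real" where e: "norm e = 1" and r: "r > 0"
      and lip: "C-lipschitz_on UNIV \<phi>"
      and loc: "\<Omega> \<inter> ball x r = {y \<in> ball x r. \<phi> (y - (y \<bullet> e) *\<^sub>R e) < y \<bullet> e}"
      using assms unfolding lipschitz_domain_def by meson
    have ee: "e \<bullet> e = 1" using e by (simp add: norm_eq_1)
    have above: "x \<bullet> e \<le> \<phi> (x - (x \<bullet> e) *\<^sub>R e)"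
      using loc \<open>x \<notin> \<Omega>\<close> r by (metis (no_types, lifting) IntE centre_in_ball leI mem_Collect_eq)
    define V where "V = ball x r \<inter> {y. y \<bullet> e < \<phi> (y - (y \<bullet> e) *\<^sub>R e)}"
    have cont: "continuous_on UNIV \<phi>" using lip by (rule lipschitz_on_continuous_on)
    have "continuous_on UNIV (\<lambda>y. \<phi> (y - (y \<bullet> e) *\<^sub>R e))"
      by (rule continuous_on_compose2[OF cont]) (auto intro!: continuous_intros)
    then have "open V"
      unfolding V_def by (intro open_Int open_ball open_Collect_less continuous_intros)
    moreover have "V \<inter> \<Omega> = {}"
      using loc unfolding V_def set_eq_iff
      by (smt (verit) IntE mem_Collect_eq empty_iff IntI)
    ultimately have disj: "V \<inter> closure \<Omega> = {}" by (simp add: open_Int_closure_eq_empty)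
    obtain \<delta> where "\<delta> > 0" and \<delta>: "ball x \<delta> \<subseteq> closure \<Omega>"
      using x by (auto simp: mem_interior)
    define t where "t = min \<delta> r / 2"
    have t: "t > 0" "t < \<delta>" "t < r" using \<open>\<delta> > 0\<close> r by (auto simp: t_def)
    \<comment> \<open>Moving from \<open>x\<close> against \<open>e\<close> keeps the argument of
      \<open>\<phi>\<close> and lowers the height by \<open>t\<close>, so \<open>y\<close> is
      strictly below the graph; \<open>t\<close> is small enough to stay in both balls.\<close>
    define y where "y = x - t *\<^sub>R e"
    have "dist x y = t" using e t by (simp add: y_def dist_norm)
    moreover have "y \<bullet> e = x \<bullet> e - t" by (simp add: y_def inner_diff_left ee)
    moreover from this have "y - (y \<bullet> e) *\<^sub>R e = x - (x \<bullet> e) *\<^sub>R e"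
      by (simp add: y_def algebra_simps)
    ultimately have "y \<in> V" "y \<in> closure \<Omega>"
      using t above \<delta> by (auto simp: V_def)
    with disj show False by blast
  qed
qed

text \<open>The simplex has full affine dimension, so its interior is its relative interior, which
  is nonempty for a nonempty convex set.\<close>

lemma conforming_mesh_element:
  fixes T :: "(real^'n) set"
  assumes "conforming_mesh \<Omega> \<T>" "T \<in> \<T>"
  shows "compact T" "convex T" "interior T \<noteq> {}"
proof -
  have s: "int CARD('n) simplex T" using assms by (auto simp: conforming_mesh_def)
  then show "compact T" "convex T" by (auto intro: compact_simplex convex_simplex)
  have "aff_dim T = DIM(real^'n)" using aff_dim_simplex[OF s] by simp
  then have "interior T = rel_interior T" "T \<noteq> {}"
    using interior_rel_interior_gen[of T] by auto
  then show "interior T \<noteq> {}" using \<open>convex T\<close> by (simp add: rel_interior_eq_empty)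
qed

text \<open>By conformity the intersection is a common face, and a proper face misses the
  interior.\<close>

lemma conforming_mesh_interior_disjoint:
  assumes "conforming_mesh \<Omega> \<T>" "T \<in> \<T>" "T' \<in> \<T>" "T \<noteq> T'"
  shows "interior T \<inter> T' = {}"
proof -
  have faces: "(T \<inter> T') face_of T" "(T \<inter> T') face_of T'"
    using assms unfolding conforming_mesh_def triangulation_def by (metis Int_commute)+
  \<comment> \<open>Otherwise \<open>T\<close> would be a proper face of \<open>T'\<close> and miss
    \<open>interior T'\<close>, although \<open>T\<close> is contained in \<open>T'\<close> and has
    interior points.\<close>
  have "T \<inter> T' \<noteq> T"
  proof
    assume "T \<inter> T' = T"
    then have "T \<inter> interior T' = {}"
      using face_of_disjoint_interior[OF faces(2)] assms(4) by auto
    moreover have "interior T \<subseteq> T \<inter> interior T'"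
      using \<open>T \<inter> T' = T\<close> by (metis inf.cobounded2 interior_mono interior_subset le_inf_iff)
    ultimately show False
      using conforming_mesh_element(3)[OF assms(1,2)] by blast
  qed
  then show ?thesis using face_of_disjoint_interior[OF faces(1)] interior_subset by blast
qed

section \<open>Frozen solutions\<close>

locale admissible =
  fixes P :: "('n::finite) cr_problem"
  assumes admissible: "admissible_problem P"
begin

lemma mesh: "conforming_mesh (Dom P) (Mesh P)"
  using admissible by (simp add: admissible_problem_def)

lemma finite_mesh: "finite (Mesh P)"
  using mesh by (simp add: conforming_mesh_def triangulation_def)

lemma element:
  assumes "T \<in> Mesh P"
  shows "T \<in> sets lebesgue" "interior T \<noteq> {}" "interior T \<in> lmeasurable" "interior T \<subseteq> Dom P"
    "measure lebesgue (interior T) \<noteq> 0" "AE x in lebesgue. x \<in> T \<longrightarrow> x \<in> interior T"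
proof -
  note T = conforming_mesh_element[OF mesh assms]
  show "T \<in> sets lebesgue" using T(1) by (simp add: fmeasurableD lmeasurable_compact)
  show "interior T \<noteq> {}" by (rule T)
  show lm: "interior T \<in> lmeasurable"
    using T(1) by (meson bounded_interior compact_imp_bounded lmeasurable_open open_interior)
  have "T \<subseteq> closure (Dom P)" using mesh assms by (auto simp: conforming_mesh_def)
  then show "interior T \<subseteq> Dom P"
    using lipschitz_domain_interior_closure[of "Dom P"] admissible interior_mono
    unfolding admissible_problem_def by blast
  show "measure lebesgue (interior T) \<noteq> 0"
    using open_not_negligible[OF open_interior T(3)] lm
    by (simp add: negligible_iff_measure)
  \<comment> \<open>The frontier of a convex set is negligible, so an element and its interior agree
    up to a null set.\<close>
  have "frontier T \<in> null_sets lebesgue"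
    using negligible_convex_frontier[OF T(2)] by (simp add: negligible_iff_null_sets)
  then have "AE x in lebesgue. x \<notin> frontier T" by (rule AE_not_in)
  then show "AE x in lebesgue. x \<in> T \<longrightarrow> x \<in> interior T"
    by eventually_elim (use closure_subset in \<open>auto simp: frontier_def\<close>)
qed

lemma AE_element_iff:
  "T \<in> Mesh P \<Longrightarrow> (AE x in lebesgue_on T. R x) \<longleftrightarrow> (AE x in lebesgue. x \<in> T \<longrightarrow> R x)"
  by (simp add: AE_lebesgue_on_iff element)

lemma Dom_in_sets [simp]: "Dom P \<in> sets lebesgue"
  using admissible by (simp add: admissible_problem_def lipschitz_domain_def borel_open)

lemma Union_in_sets: "\<A> \<subseteq> Mesh P \<Longrightarrow> \<Union>\<A> \<in> sets lebesgue"
  by (rule sets.finite_Union) (use finite_subset finite_mesh element in auto)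

lemma AE_UnionI:
  assumes "\<A> \<subseteq> Mesh P" "\<And>T. T \<in> \<A> \<Longrightarrow> AE x in lebesgue_on T. R x"
  shows "AE x in lebesgue. x \<in> \<Union>\<A> \<longrightarrow> R x"
proof -
  have "AE x in lebesgue. \<forall>T\<in>\<A>. x \<in> T \<longrightarrow> R x"
    using assms finite_subset[OF assms(1) finite_mesh]
    by (subst AE_ball_countable) (auto simp: countable_finite AE_element_iff subset_iff)
  then show ?thesis by eventually_elim auto
qed

lemma AE_DomI:
  assumes "\<And>T. T \<in> Mesh P \<Longrightarrow> AE x in lebesgue_on T. R x"
  shows "AE x in lebesgue_on (Dom P). R x"
proof -
  have "Dom P \<subseteq> \<Union>(Mesh P)" using mesh closure_subset by (auto simp: conforming_mesh_def)
  with AE_UnionI[OF order_refl assms] show ?thesis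
    by (auto simp: AE_lebesgue_on_iff elim!: eventually_mono)
qed

section \<open>Elementwise constancy of divergence and pressure\<close>

text \<open>The constant is the trace of the matrix of the affine polynomial on \<open>T\<close>.
  Only interior points are covered, since \<open>broken_div\<close> takes its default value 0 on the
  frontier.\<close>

lemma broken_div_const:
  assumes "v \<in> CR_space P w" "T \<in> Mesh P"
  shows "\<exists>c. \<forall>x \<in> interior T. broken_div (Mesh P) v x = c"
proof -
  obtain a where a: "a \<in> affine_fields" "AE x in lebesgue_on T. v x = a x"
    using assms by (auto simp: CR_space_def)
  obtain A b where ab: "a = (\<lambda>x. A *v x + b)" using a by (auto simp: affine_fields_def)
  have "elem_poly v T = a" using elem_poly_eqI[OF _ _ a] element[OF assms(2)] by blast
  show ?thesis
  proof (intro exI ballI)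
    fix x assume x: "x \<in> interior T"
    \<comment> \<open>An interior point of \<open>T\<close> lies in no other element, so the
      description in \<open>broken_grad\<close> selects \<open>T\<close>.\<close>
    then have "(THE T. T \<in> Mesh P \<and> x \<in> interior T) = T"
      using conforming_mesh_interior_disjoint[OF mesh] assms(2) interior_subset
      by (intro the_equality) blast+
    then show "broken_div (Mesh P) v x = trace A"
      using x assms(2) \<open>elem_poly v T = a\<close>
      by (auto simp: broken_div_def broken_grad_def ab jacobian_affine)
  qed
qed

lemma broken_div_AE:
  assumes "v \<in> CR_space P w" "T \<in> Mesh P"
  shows "AE x in lebesgue_on T. broken_div (Mesh P) v x = elem_val (broken_div (Mesh P) v) T"
proof -
  obtain c where "\<forall>x \<in> interior T. broken_div (Mesh P) v x = c"
    using broken_div_const[OF assms] by blast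
  then have c: "AE x in lebesgue_on T. broken_div (Mesh P) v x = c"
    using element(6)[OF assms(2)] assms(2) by (auto simp: AE_element_iff elim: eventually_mono)
  with elem_val_eqI[OF element(1,2)[OF assms(2)] c] show ?thesis by simp
qed

lemma Q_space_AE:
  assumes "q \<in> Q_space P" "T \<in> Mesh P"
  shows "AE x in lebesgue_on T. q x = elem_val q T"
proof -
  obtain c where c: "AE x in lebesgue_on T. q x = c" using assms by (auto simp: Q_space_def)
  with elem_val_eqI[OF element(1,2)[OF assms(2)] c] show ?thesis by simp
qed

section \<open>Test functions\<close>

text \<open>\<open>frozen_solution\<close> quantifies over the velocity and pressure test functions
  jointly; the zero field supplies the former when only the second equation is wanted.\<close>

lemma zero_in_CR_space: "(\<lambda>x. 0) \<in> CR_space P (\<lambda>x. 0)"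
proof -
  have aff: "(\<lambda>x. 0) \<in> (affine_fields :: (real^'n \<Rightarrow> real^'n) set)"
    by (auto simp: affine_fields_def intro!: exI[of _ 0])
  have poly: "elem_poly (\<lambda>x. 0) T = (\<lambda>x. 0)" if "T \<in> Mesh P" for T
    using elem_poly_eqI[OF element(1,2)[OF that] aff] by simp
  have jump: "jump (Mesh P) F (\<lambda>x. 0) x = 0" if F: "F \<in> mesh_faces (Mesh P)" for F x
  proof -
    \<comment> \<open>The choice of the plus side in \<open>jump\<close> yields a mesh element only
      if the face has an adjacent one.\<close>
    have "\<exists>T. T \<in> elements_at (Mesh P) F"
      using F by (auto simp: mesh_faces_def elements_at_def)
    then have "(SOME T. T \<in> elements_at (Mesh P) F) \<in> elements_at (Mesh P) F" by (rule someI_ex)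
    then show ?thesis by (auto simp: jump_def Let_def poly elements_at_def intro!: sum.neutral)
  qed
  show ?thesis
    using aff
    by (auto simp: CR_space_def L2_space_def jump interior_faces_def faces_on_def
        boundary_faces_def tangential_def face_integral_def set_lebesgue_integral_def)
qed

text \<open>The interior is used rather than \<open>T\<close> because it lies in the domain and
  misses every other element exactly, so shared faces cause no exceptional sets there.\<close>

lemma indicator_in_Q_space:
  assumes T: "T \<in> Mesh P"
  shows "indicator (interior T) \<in> Q_space P"
proof -
  let ?i = "indicator (interior T) :: real^'n \<Rightarrow> real"
  have meas: "?i \<in> borel_measurable (lebesgue_on (Dom P))"
    using element[OF T] by (intro measurable_restrict_space1) (auto simp: fmeasurableD)
  have "integrable lebesgue ?i"
    using element[OF T] by (simp add: integrable_indicator_iff fmeasurable_def)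
  then have "integrable (lebesgue_on (Dom P)) ?i"
    by (intro integrable_restrict_space[THEN iffD2] integrable_mult_indicator) auto
  moreover have "(\<lambda>x. (norm (?i x))\<^sup>2) = ?i" by (auto simp: indicator_def)
  ultimately have "?i \<in> L2_space (Dom P)" using meas by (simp add: L2_space_def)
  moreover have "\<exists>c. AE x in lebesgue_on T'. ?i x = c" if T': "T' \<in> Mesh P" for T'
  proof (cases "T' = T")
    case True
    then show ?thesis using element(6)[OF T] T
      by (intro exI[of _ 1]) (auto simp: AE_element_iff elim!: eventually_mono)
  next
    case False
    then have "interior T \<inter> T' = {}"
      using conforming_mesh_interior_disjoint[OF mesh T T'] by auto
    then show ?thesis using T'
      by (intro exI[of _ 0]) (auto simp: AE_element_iff indicator_def)
  qed
  ultimately show ?thesis by (simp add: Q_space_def)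
qed

section \<open>Vanishing element values and independence of the parameter\<close>

text \<open>\<open>interior T\<close> lies entirely inside or entirely outside
  \<open>\<Union>\<A>\<close>, so only one of the two integrals in the tested equation survives. It
  is an element value times the nonzero measure of \<open>interior T\<close>, with the factor
  \<open>\<gamma>\<close> to cancel in the inactive case.\<close>

lemma frozen_solution_elementwise:
  assumes "\<A> \<subseteq> Mesh P" "frozen_solution P \<gamma> \<A> u p" "\<gamma> > 0" "T \<in> Mesh P"
  shows "T \<in> \<A> \<Longrightarrow> elem_val (broken_div (Mesh P) u) T = 0"
    and "T \<notin> \<A> \<Longrightarrow> elem_val p T = 0"
proof -
  let ?d = "broken_div (Mesh P) u" and ?I = "interior T"
  have u: "u \<in> CR_space P (dirichlet P)" and p: "p \<in> Q_space P"
    using assms(2) by (auto simp: frozen_solution_def)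
  have eq: "- L2_inner (\<Union>\<A>) ?d (indicator ?I)
      - \<gamma> * L2_inner (Dom P - \<Union>\<A>) p (indicator ?I) = 0"
    using assms(2) zero_in_CR_space indicator_in_Q_space[OF assms(4)]
    unfolding frozen_solution_def by blast
  note T = element[OF assms(4)]
  \<comment> \<open>The set \<open>S\<close> is left free so that the fact serves both the active
    region and its complement.\<close>
  have AE: "AE x in lebesgue. x \<in> S \<inter> ?I \<longrightarrow> f x = elem_val f T"
    if "AE x in lebesgue_on T. f x = elem_val f T" for f :: "real^'n \<Rightarrow> real" and S
    using that interior_subset[of T] assms(4) by (auto simp: AE_element_iff elim!: eventually_mono)
  have d: "L2_inner (\<Union>\<A>) ?d (indicator ?I) = elem_val ?d T * measure lebesgue (\<Union>\<A> \<inter> ?I)"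
    by (intro L2_inner_indicator Union_in_sets assms(1) T AE broken_div_AE[OF u] assms(4))
  have q: "L2_inner (Dom P - \<Union>\<A>) p (indicator ?I)
      = elem_val p T * measure lebesgue ((Dom P - \<Union>\<A>) \<inter> ?I)"
    by (intro L2_inner_indicator sets.Diff Dom_in_sets Union_in_sets assms(1) T AE
        Q_space_AE[OF p] assms(4))
  show "elem_val ?d T = 0" if "T \<in> \<A>"
  proof -
    have "\<Union>\<A> \<inter> ?I = ?I" "(Dom P - \<Union>\<A>) \<inter> ?I = {}" using that interior_subset[of T] by auto
    then show ?thesis using eq T(5) by (simp add: d q)
  qed
  show "elem_val p T = 0" if "T \<notin> \<A>"
  proof -
    have "\<Union>\<A> \<inter> ?I = {}"
      using conforming_mesh_interior_disjoint[OF mesh assms(4)] that assms(1) by blast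
    moreover from this have "(Dom P - \<Union>\<A>) \<inter> ?I = ?I" using T(4) by auto
    ultimately show ?thesis using eq T(5) \<open>\<gamma> > 0\<close> by (simp add: d q)
  qed
qed

lemma frozen_solution_change_parameter:
  assumes "\<A> \<subseteq> Mesh P" "frozen_solution P \<gamma> \<A> u p" "\<gamma> > 0"
  shows "frozen_solution P \<gamma>' \<A> u p"
proof -
  have u: "u \<in> CR_space P (dirichlet P)" and p: "p \<in> Q_space P"
    using assms(2) by (auto simp: frozen_solution_def)
  have "AE x in lebesgue. x \<in> \<Union>\<A> \<longrightarrow> broken_div (Mesh P) u x = 0"
  proof (rule AE_UnionI[OF assms(1)])
    fix T assume "T \<in> \<A>"
    moreover from this have "T \<in> Mesh P" using assms(1) by blast
    ultimately show "AE x in lebesgue_on T. broken_div (Mesh P) u x = 0"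
      using broken_div_AE[OF u] frozen_solution_elementwise(1)[OF assms] by metis
  qed
  then have d: "L2_inner (\<Union>\<A>) (broken_div (Mesh P) u) g = 0" for g
    by (intro L2_inner_eq_zero_left Union_in_sets assms(1))
  \<comment> \<open>Stated as an implication on the whole domain so that it can be checked element
    by element; on an active element the premise is false at every point.\<close>
  have "AE x in lebesgue_on (Dom P). x \<in> Dom P - \<Union>\<A> \<longrightarrow> p x = 0"
  proof (rule AE_DomI)
    fix T assume T: "T \<in> Mesh P"
    show "AE x in lebesgue_on T. x \<in> Dom P - \<Union>\<A> \<longrightarrow> p x = 0"
    proof (cases "T \<in> \<A>")
      case True
      then show ?thesis using T by (auto simp: AE_element_iff)
    next
      case False
      then have "AE x in lebesgue_on T. p x = 0"
        using Q_space_AE[OF p T] frozen_solution_elementwise(2)[OF assms T] by simp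
      then show ?thesis by (auto elim: eventually_mono)
    qed
  qed
  then have "AE x in lebesgue. x \<in> Dom P - \<Union>\<A> \<longrightarrow> p x = 0"
    by (auto simp: AE_lebesgue_on_iff elim: eventually_mono)
  then have q: "L2_inner (Dom P - \<Union>\<A>) p g = 0" for g
    by (intro L2_inner_eq_zero_left sets.Diff Dom_in_sets Union_in_sets assms(1))
  \<comment> \<open>After rewriting, the first equation has lost its \<open>\<gamma>\<close> term
    and the second reads 0 = 0, so both systems coincide at \<open>u\<close> and
    \<open>p\<close>.\<close>
  show ?thesis using assms(2) unfolding frozen_solution_def d q by simp
qed

text \<open>On each element one of the two terms of the test vanishes. What is left is either free
  of the parameter or a positive multiple of the pressure, so its sign does not change.\<close>

lemma active_update_change_parameter:
  assumes "\<A> \<subseteq> Mesh P" "frozen_solution P \<gamma> \<A> u p" "\<gamma> > 0" "\<gamma>' > 0"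
  shows "active_update P \<gamma>' u p = active_update P \<gamma> u p"
proof -
  have "\<gamma>' * elem_val p T - elem_val (broken_div (Mesh P) u) T \<ge> 0 \<longleftrightarrow>
      \<gamma> * elem_val p T - elem_val (broken_div (Mesh P) u) T \<ge> 0" if "T \<in> Mesh P" for T
    using frozen_solution_elementwise[OF assms(1-3) that] assms(3,4)
    by (cases "T \<in> \<A>") (auto simp: zero_le_mult_iff)
  then show ?thesis by (auto simp: active_update_def)
qed

lemma fixed_point_change_parameter:
  assumes "fixed_point P \<gamma> \<A> u p" "\<gamma> > 0" "\<gamma>' > 0"
  shows "fixed_point P \<gamma>' \<A> u p"
proof -
  have fp: "\<A> \<subseteq> Mesh P" "frozen_solution P \<gamma> \<A> u p" "active_update P \<gamma> u p = \<A>"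
    using assms(1) unfolding fixed_point_def by blast+
  have "active_update P \<gamma>' u p = \<A>"
    using active_update_change_parameter[OF fp(1,2) assms(2,3)] fp(3) by (rule trans)
  with fp(1) frozen_solution_change_parameter[OF fp(1,2) assms(2)]
  show ?thesis unfolding fixed_point_def by blast
qed

section \<open>Signs at a fixed point and the Kuhn-Tucker conditions\<close>

text \<open>Inserting the vanishing value into the test leaves the sign of the other quantity. The
  divergence is strictly positive off \<open>\<A>\<close> because ties are assigned to
  \<open>\<A>\<close>.\<close>

lemma fixed_point_signs:
  assumes "\<A> \<subseteq> Mesh P" "frozen_solution P \<gamma> \<A> u p" "\<gamma> > 0"
    and \<A>: "\<A> = active_update P \<gamma> u p" and T: "T \<in> Mesh P"
  shows "T \<in> \<A> \<Longrightarrow> elem_val p T \<ge> 0"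
    and "T \<notin> \<A> \<Longrightarrow> elem_val (broken_div (Mesh P) u) T > 0"
proof -
  have iff: "T \<in> \<A> \<longleftrightarrow> \<gamma> * elem_val p T - elem_val (broken_div (Mesh P) u) T \<ge> 0"
    using T unfolding \<A>[THEN eqset_imp_iff] active_update_def by blast
  show "elem_val p T \<ge> 0" if "T \<in> \<A>"
    using frozen_solution_elementwise(1)[OF assms(1-3) T that] iff that assms(3)
    by (simp add: zero_le_mult_iff)
  show "elem_val (broken_div (Mesh P) u) T > 0" if "T \<notin> \<A>"
    using frozen_solution_elementwise(2)[OF assms(1-3) T that] iff that by simp
qed

lemma frozen_solution_complementarity:
  assumes "\<A> \<subseteq> Mesh P" "frozen_solution P \<gamma> \<A> u p" "\<gamma> > 0" "T \<in> Mesh P"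
  shows "elem_val p T * elem_val (broken_div (Mesh P) u) T = 0"
  using frozen_solution_elementwise[OF assms] by (cases "T \<in> \<A>") auto

text \<open>Carries a relation between element values over to the functions: both are almost
  everywhere equal to their element values, and the elements cover the domain.\<close>

lemma frozen_solution_AE_DomI:
  assumes "frozen_solution P \<gamma> \<A> u p"
    and "\<And>T. T \<in> Mesh P \<Longrightarrow> R (elem_val p T) (elem_val (broken_div (Mesh P) u) T)"
  shows "AE x in lebesgue_on (Dom P). R (p x) (broken_div (Mesh P) u x)"
proof (rule AE_DomI)
  fix T assume T: "T \<in> Mesh P"
  have "u \<in> CR_space P (dirichlet P)" "p \<in> Q_space P"
    using assms(1) by (auto simp: frozen_solution_def)
  from broken_div_AE[OF this(1) T] Q_space_AE[OF this(2) T]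
  show "AE x in lebesgue_on T. R (p x) (broken_div (Mesh P) u x)"
    by eventually_elim (simp add: assms(2)[OF T])
qed

text \<open>Active elements have zero divergence and nonnegative pressure, the others zero pressure
  and positive divergence; either case gives all three conditions.\<close>

lemma fixed_point_Kuhn_Tucker:
  assumes "fixed_point P \<gamma> \<A> u p" "\<gamma> > 0" "T \<in> Mesh P"
  shows "elem_val p T \<ge> 0 \<and> elem_val (broken_div (Mesh P) u) T \<ge> 0 \<and>
    elem_val p T * elem_val (broken_div (Mesh P) u) T = 0"
proof -
  have fp: "\<A> \<subseteq> Mesh P" "frozen_solution P \<gamma> \<A> u p" "\<A> = active_update P \<gamma> u p"
    using assms(1) unfolding fixed_point_def by blast+
  show ?thesis
    using frozen_solution_elementwise[OF fp(1,2) assms(2,3)]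
      fixed_point_signs[OF fp(1,2) assms(2) fp(3) assms(3)]
    by (cases "T \<in> \<A>") auto
qed

end

section \<open>Assembly of the five claims\<close>

theorem theorem3p2:
  fixes P :: "('n::finite) cr_problem" and \<gamma> :: real
  assumes "admissible_problem P" and "\<gamma> > 0"
  shows
    "(\<forall>\<A> u p. \<A> \<subseteq> Mesh P \<and> frozen_solution P \<gamma> \<A> u p \<longrightarrow>
        ((\<forall>T \<in> \<A>. elem_val (broken_div (Mesh P) u) T = 0) \<and>
         (\<forall>T \<in> Mesh P - \<A>. elem_val p T = 0) \<and>
         (\<forall>T \<in> Mesh P. elem_val p T * elem_val (broken_div (Mesh P) u) T = 0) \<and>
         (AE x in lebesgue_on (Dom P). p x * broken_div (Mesh P) u x = 0)) \<and>
        ((\<forall>T \<in> \<A>. \<gamma> * elem_val p T - elem_val (broken_div (Mesh P) u) T = \<gamma> * elem_val p T) \<and>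
         (\<forall>T \<in> Mesh P - \<A>. \<gamma> * elem_val p T - elem_val (broken_div (Mesh P) u) T
                              = - elem_val (broken_div (Mesh P) u) T)) \<and>
        (\<A> = {T \<in> Mesh P. \<gamma> * elem_val p T - elem_val (broken_div (Mesh P) u) T \<ge> 0} \<longrightarrow>
           (\<forall>T \<in> \<A>. elem_val p T \<ge> 0) \<and>
           (\<forall>T \<in> Mesh P - \<A>. elem_val (broken_div (Mesh P) u) T > 0)))
     \<and>
     (\<forall>\<gamma>'>0.
        (\<forall>\<A> \<subseteq> Mesh P. {(u, p). frozen_solution P \<gamma> \<A> u p} = {(u, p). frozen_solution P \<gamma>' \<A> u p}) \<and>
        {(\<A>, u, p). fixed_point P \<gamma> \<A> u p} = {(\<A>, u, p). fixed_point P \<gamma>' \<A> u p})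
     \<and>
     (\<forall>\<A> u p. fixed_point P \<gamma> \<A> u p \<longrightarrow>
        (\<forall>T \<in> Mesh P. elem_val p T \<ge> 0 \<and> elem_val (broken_div (Mesh P) u) T \<ge> 0 \<and>
                       elem_val p T * elem_val (broken_div (Mesh P) u) T = 0) \<and>
        (AE x in lebesgue_on (Dom P). p x \<ge> 0 \<and> broken_div (Mesh P) u x \<ge> 0 \<and>
                       p x * broken_div (Mesh P) u x = 0) \<and>
        p \<in> Q_plus (Dom P))"
proof -
  interpret admissible P by standard (rule assms)
  note \<gamma> = \<open>\<gamma> > 0\<close>
  show ?thesis
  \<comment> \<open>The three goals are claims (i) to (iii), claim (iv), and claim (v).\<close>
  proof (intro conjI, goal_cases)
    case 1
    show ?case
    proof (intro allI impI, elim conjE, goal_cases)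
      case (1 \<A> u p)
      note frozen = 1 \<gamma>
      have mesh: "T \<in> Mesh P" if "T \<in> \<A>" for T using that 1(1) by blast
      have vals: "\<forall>T\<in>\<A>. elem_val (broken_div (Mesh P) u) T = 0"
        "\<forall>T\<in>Mesh P - \<A>. elem_val p T = 0"
        "\<forall>T\<in>Mesh P. elem_val p T * elem_val (broken_div (Mesh P) u) T = 0"
        using frozen_solution_elementwise[OF frozen] frozen_solution_complementarity[OF frozen] mesh
        by blast+
      have AE: "AE x in lebesgue_on (Dom P). p x * broken_div (Mesh P) u x = 0"
        using frozen_solution_AE_DomI[OF 1(2), of "\<lambda>a b. a * b = 0"] vals(3) by blast
      have test: "\<forall>T\<in>\<A>. \<gamma> * elem_val p T - elem_val (broken_div (Mesh P) u) T = \<gamma> * elem_val p T"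
        "\<forall>T\<in>Mesh P - \<A>. \<gamma> * elem_val p T - elem_val (broken_div (Mesh P) u) T
          = - elem_val (broken_div (Mesh P) u) T"
        using vals by simp_all
      have signs: "\<forall>T\<in>\<A>. elem_val p T \<ge> 0"
        "\<forall>T\<in>Mesh P - \<A>. elem_val (broken_div (Mesh P) u) T > 0"
        if "\<A> = {T \<in> Mesh P. \<gamma> * elem_val p T - elem_val (broken_div (Mesh P) u) T \<ge> 0}"
        using fixed_point_signs[OF frozen that[folded active_update_def]] mesh by blast+
      show ?case
        by (intro conjI impI vals AE test signs)
    qed
  next
    case 2
    show ?case
    proof (intro allI impI conjI)
      fix \<gamma>' :: real and \<A> assume \<gamma>': "\<gamma>' > 0" and "\<A> \<subseteq> Mesh P"
      \<comment> \<open>The change of parameter is an implication; exchanging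
        \<open>\<gamma>\<close> and \<open>\<gamma>'\<close> gives the converse, hence equality of
        the solution sets.\<close>
      then have "frozen_solution P \<gamma> \<A> u p \<longleftrightarrow> frozen_solution P \<gamma>' \<A> u p" for u p
        using frozen_solution_change_parameter \<gamma> by blast
      then show "{(u, p). frozen_solution P \<gamma> \<A> u p} = {(u, p). frozen_solution P \<gamma>' \<A> u p}"
        by simp
    next
      fix \<gamma>' :: real assume "\<gamma>' > 0"
      then have "fixed_point P \<gamma> \<A> u p \<longleftrightarrow> fixed_point P \<gamma>' \<A> u p" for \<A> u p
        using fixed_point_change_parameter \<gamma> by blast
      then show "{(\<A>, u, p). fixed_point P \<gamma> \<A> u p} = {(\<A>, u, p). fixed_point P \<gamma>' \<A> u p}"
        by simp
    qed
  next
    case 3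
    show ?case
    proof (intro allI impI, goal_cases)
      case (1 \<A> u p)
      note KT = fixed_point_Kuhn_Tucker[OF 1 \<gamma>]
      have frozen: "frozen_solution P \<gamma> \<A> u p" using 1 by (simp add: fixed_point_def)
      have AE: "AE x in lebesgue_on (Dom P). p x \<ge> 0 \<and> broken_div (Mesh P) u x \<ge> 0 \<and>
          p x * broken_div (Mesh P) u x = 0"
        using frozen_solution_AE_DomI[OF frozen, of "\<lambda>a b. a \<ge> 0 \<and> b \<ge> 0 \<and> a * b = 0"] KT by blast
      have "p \<in> L2_space (Dom P)" using frozen by (simp add: frozen_solution_def Q_space_def)
      moreover have "AE x in lebesgue_on (Dom P). p x \<ge> 0" using AE by (auto elim: eventually_mono)
      ultimately have "p \<in> Q_plus (Dom P)" by (simp add: Q_plus_def)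
      with AE KT show ?case by blast
    qed
  qed
qed

end
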